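(* Let $n\ge 3$ be an integer and $x>1$ a real number. Then $0$ is an eigenvalue of $\mathbf{CPC}(x,n)$ of (algebraic) multiplicity $n-3$, and the three non-zero eigenvalues of $\mathbf{CPC}(x,n)$ are one positive real number and two complex conjugate non-real numbers. The Perron root of $\mathbf{CPC}(x,n)$ is $$\lambda_{\max}(x,n)=B(x,n)+\frac{n^2}{9B(x,n)}+\frac n3,$$ where $$B(x,n)=\left(\frac{n^3}{27}+\frac{(x-1)\sqrt{4n^3(n-2)x+27(n-2)^2(x-1)^2}}{6\sqrt3\,x}+\frac{(n-2)(x-1)^2}{2x}\right)^{1/3}.$$
   Context: The corner pairwise comparisons matrix $\mathbf{CPC}(x,n)=(a_{ij})_{i,j=1}^n$ has $a_{1n}=x$, $a_{n1}=1/x$, and all other entries equal to $1$. The Perron root $\lambda_{\max}$ of a square matrix with positive entries is its spectral radius (which is an eigenvalue). Multiplicity $0$ (when $n=3$) means that $0$ is not an eigenvalue. *)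

theory Defs
  imports "Jordan_Normal_Form.Spectral_Radius"
begin

(* Matrices are indexed from 0, so the corners (1,n) and (n,1) are (0,n-1) and (n-1,0).
   Only meant for n >= 2. *)
definition CPC :: "real \<Rightarrow> nat \<Rightarrow> real mat" where
  "CPC x n = mat n n (\<lambda>(i, j).
     if i = 0 \<and> j = n - 1 then x
     else if i = n - 1 \<and> j = 0 then 1 / x
     else 1)"

(* The entries are viewed as complex numbers, so that eigenvalue, spectrum, char_poly and
   spectral_radius of this matrix see the non-real eigenvalues as well. *)
abbreviation CPC_complex :: "real \<Rightarrow> nat \<Rightarrow> complex mat" where
  "CPC_complex x n \<equiv> map_mat complex_of_real (CPC x n)"

definition perron_root :: "real mat \<Rightarrow> real" where
  "perron_root A = spectral_radius (map_mat complex_of_real A)"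

definition alg_mult :: "complex mat \<Rightarrow> complex \<Rightarrow> nat" where
  "alg_mult A \<mu> = Polynomial.order \<mu> (char_poly A)"

definition CPC_B :: "real \<Rightarrow> nat \<Rightarrow> real" where
  "CPC_B x n = root 3
     (real n ^ 3 / 27
      + (x - 1) * sqrt (4 * real n ^ 3 * (real n - 2) * x + 27 * (real n - 2)\<^sup>2 * (x - 1)\<^sup>2)
          / (6 * sqrt 3 * x)
      + (real n - 2) * (x - 1)\<^sup>2 / (2 * x))"

end

theory Submission
  imports Defs
begin

text \<open>The corner matrix has only three distinct kinds of rows: the first, the last, and the
  \<open>n - 2\<close> identical rows of ones between them. It therefore factors as \<open>U V\<close> through a
  three-dimensional space, and \<open>U V\<close> and the \<open>3 \<times> 3\<close> matrix \<open>V U\<close> have the same characteristic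
  polynomial up to a power of the indeterminate (\<open>char_poly_mult_swap\<close>). The determinant of a
  \<open>3 \<times> 3\<close> matrix then gives
  \<open>\<lambda>\<^sup>n\<^sup>-\<^sup>3 (\<lambda>\<^sup>3 - n \<lambda>\<^sup>2 - c)\<close> with \<open>c = (n - 2) (x - 1)\<^sup>2 / x > 0\<close> (\<open>char_poly_CPC\<close>), and the cubic
  factor does not vanish at \<open>0\<close>; this is the claim about the multiplicity of \<open>0\<close>.

  The substitution \<open>\<lambda> = t + n / 3\<close> makes the cubic depressed, and Cardano's formula produces a
  real root \<open>r\<close>, which is the expression in the theorem and exceeds \<open>n\<close> (\<open>cardano\<close>,
  \<open>CPC_B_cube\<close>). Any real root \<open>r > n\<close> forces the other two roots to be non-real conjugates
  of modulus below \<open>r\<close> (\<open>cubic_roots\<close>), so \<open>r\<close> is the spectral radius.\<close>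

section \<open>Characteristic polynomials of the two products of rectangular matrices\<close>

lemma char_poly_lower_block:
  fixes A :: "'a :: idom mat"
  assumes A: "A \<in> carrier_mat n n" and C: "C \<in> carrier_mat m n" and D: "D \<in> carrier_mat m m"
  shows "char_poly (four_block_mat A (0\<^sub>m n m) C D) = char_poly A * char_poly D"
proof -
  let ?C = "map_mat (\<lambda>a. [:- a:]) C"
  have "char_poly_matrix (four_block_mat A (0\<^sub>m n m) C D) =
      four_block_mat (char_poly_matrix A) (0\<^sub>m n m) ?C (char_poly_matrix D)"
    unfolding char_poly_matrix_def
    by (rule eq_matI) (use A C D in \<open>auto simp: one_poly_def\<close>)
  then show ?thesis
    using A C D unfolding char_poly_def
    by (simp add: det_four_block_mat_upper_right_zero[of _ n _ m])
qed

lemma char_poly_zero_mat: "char_poly (0\<^sub>m n n :: 'a :: idom mat) = monom 1 n"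
proof -
  have "char_poly_matrix (0\<^sub>m n n :: 'a mat) = [:0, 1:] \<cdot>\<^sub>m 1\<^sub>m n"
    unfolding char_poly_matrix_def by (rule eq_matI) auto
  then show ?thesis
    by (simp add: char_poly_def det_smult monom_altdef)
qed

text \<open>The block matrices \<open>L = [U V, 0; V, 0]\<close> and \<open>R = [0, 0; V, V U]\<close> are similar through the
  unipotent matrix \<open>P = [1, U; 0, 1]\<close>, because \<open>L P\<close> and \<open>P R\<close> both equal
  \<open>[U V, U V U; V, V U]\<close>. Both are block triangular, which makes their characteristic
  polynomials the two sides of the equation.\<close>

lemma char_poly_mult_swap:
  fixes U :: "'a :: idom mat"
  assumes U: "U \<in> carrier_mat n m" and V: "V \<in> carrier_mat m n"
  shows "monom 1 m * char_poly (U * V) = monom 1 n * char_poly (V * U)"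
proof -
  define P where "P = four_block_mat (1\<^sub>m n) U (0\<^sub>m m n) (1\<^sub>m m)"
  define Q where "Q = four_block_mat (1\<^sub>m n) (- U) (0\<^sub>m m n) (1\<^sub>m m)"
  define L where "L = four_block_mat (U * V) (0\<^sub>m n m) V (0\<^sub>m m m)"
  define R where "R = four_block_mat (0\<^sub>m n n) (0\<^sub>m n m) V (V * U)"
  have carr: "P \<in> carrier_mat (n + m) (n + m)" "Q \<in> carrier_mat (n + m) (n + m)"
    "L \<in> carrier_mat (n + m) (n + m)" "R \<in> carrier_mat (n + m) (n + m)"
    using U V by (auto simp: P_def Q_def L_def R_def)
  have U0: "U + - U = 0\<^sub>m n m" "- U + U = 0\<^sub>m n m" "- (0\<^sub>m m m) = (0\<^sub>m m m :: 'a mat)"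
    by (rule eq_matI; use U in simp)+
  have PQ: "P * Q = 1\<^sub>m (n + m)" and QP: "Q * P = 1\<^sub>m (n + m)"
    unfolding P_def Q_def
    by (subst mult_four_block_mat[of _ n n _ m _ m _ _ n _ m];
        use U V in \<open>simp add: U0\<close>)+
  have "P * R = four_block_mat (U * V) (U * (V * U)) V (V * U)"
    unfolding P_def R_def
    by (subst mult_four_block_mat[of _ n n _ m _ m _ _ n _ m]) (use U V in auto)
  moreover have "L * P = four_block_mat (U * V) (U * (V * U)) V (V * U)"
    unfolding P_def L_def
    by (subst mult_four_block_mat[of _ n n _ m _ m _ _ n _ m]) (use U V in auto)
  ultimately have "P * R = L * P" by simp
  then have "P * R * Q = L * (P * Q)"
    using carr by (simp add: assoc_mult_mat[of L _ _ P _ Q])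
  then have "L = P * R * Q" using PQ carr by simp
  then have "similar_mat L R"
    by (intro similar_matI[OF _ PQ QP]) (use carr in auto)
  then have "char_poly L = char_poly R" by (rule char_poly_similar)
  then show ?thesis
    unfolding L_def R_def using U V
    by (simp add: char_poly_lower_block[of _ n _ m] char_poly_zero_mat mult.commute)
qed

section \<open>The characteristic polynomial of the corner matrix\<close>

text \<open>The columns are the indicators of the first index, of the middle indices and of the last
  index: row \<open>i\<close> selects the kind of row that the corner matrix has at \<open>i\<close>.\<close>

definition corner_left :: "nat \<Rightarrow> complex mat" where
  "corner_left n = mat n 3 (\<lambda>(i, j). if i = 0 then (if j = 0 then 1 else 0)
     else if i = n - 1 then (if j = 2 then 1 else 0) else (if j = 1 then 1 else 0))"

text \<open>The three kinds of rows of the corner matrix: its first row, a middle row and its last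
  row.\<close>

definition corner_right :: "real \<Rightarrow> nat \<Rightarrow> complex mat" where
  "corner_right x n = mat 3 n (\<lambda>(i, j). if i = 0 \<and> j = n - 1 then of_real x
     else if i = 2 \<and> j = 0 then of_real (1 / x) else 1)"

lemma CPC_factor:
  assumes "n \<ge> 2"
  shows "CPC_complex x n = corner_left n * corner_right x n"
  by (rule eq_matI)
    (use assms in \<open>auto simp: CPC_def corner_left_def corner_right_def scalar_prod_def numeral_3_eq_3\<close>)

lemma corner_right_mult_left:
  assumes "n \<ge> 2"
  shows "corner_right x n * corner_left n = mat 3 3 (\<lambda>(i, j).
     if i = 0 \<and> j = 2 then of_real x
     else if i = 2 \<and> j = 0 then of_real (1 / x)
     else if j = 1 then of_nat (n - 2)
     else 1)"
proof (rule eq_matI, goal_cases)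
  case (1 i j)
  have split: "sum f {0..<n} = f 0 + f (n - 1) + sum f {1..<n - 1}" for f :: "nat \<Rightarrow> complex"
  proof -
    have "{0..<n} = insert 0 (insert (n - 1) {1..<n - 1})" using assms by auto
    then show ?thesis using assms by (simp add: add.assoc)
  qed
  have "i < 3" "j < 3" using 1 by auto
  then show ?case
    using assms by (simp add: corner_right_def corner_left_def scalar_prod_def split)
qed (auto simp: corner_right_def corner_left_def)

lemma det_3:
  fixes A :: "'a :: comm_ring_1 mat"
  assumes A: "A \<in> carrier_mat 3 3"
  shows "det A = A $$ (0,0) * (A $$ (1,1) * A $$ (2,2) - A $$ (1,2) * A $$ (2,1))
    - A $$ (1,0) * (A $$ (0,1) * A $$ (2,2) - A $$ (0,2) * A $$ (2,1))
    + A $$ (2,0) * (A $$ (0,1) * A $$ (1,2) - A $$ (0,2) * A $$ (1,1))"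
proof -
  have det2: "det B = B $$ (0,0) * B $$ (1,1) - B $$ (0,1) * B $$ (1,0)"
    if B: "B \<in> carrier_mat 2 2" for B :: "'a mat"
    using B by (subst laplace_expansion_column[OF B, of 0])
      (auto simp: numeral_2_eq_2 cofactor_def mat_delete_def det_single algebra_simps)
  show ?thesis
    using A by (subst laplace_expansion_column[OF A, of 0])
      (auto simp: numeral_2_eq_2 numeral_3_eq_3 cofactor_def mat_delete_def det2 algebra_simps)
qed

lemma char_poly_corner_right_mult_left:
  assumes "n \<ge> 2" and "x \<noteq> 0"
  shows "char_poly (corner_right x n * corner_left n) =
    [:- of_real ((real n - 2) * (x - 1)\<^sup>2 / x), 0, - of_nat n, 1:]"
  unfolding corner_right_mult_left[OF assms(1)] char_poly_def char_poly_matrix_def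
  by (subst det_3)
    (use assms in \<open>simp_all add: one_pCons of_nat_diff field_simps power2_eq_square del: pCons_one\<close>)

lemma char_poly_CPC:
  assumes "n \<ge> 3" and "x \<noteq> 0"
  shows "char_poly (CPC_complex x n) =
    monom 1 (n - 3) * [:- of_real ((real n - 2) * (x - 1)\<^sup>2 / x), 0, - of_nat n, 1:]"
    (is "_ = _ * ?q")
proof -
  have "monom 1 3 * char_poly (corner_left n * corner_right x n) =
      monom 1 n * char_poly (corner_right x n * corner_left n)"
    by (rule char_poly_mult_swap) (auto simp: corner_left_def corner_right_def)
  also have "char_poly (corner_right x n * corner_left n) = ?q"
    by (rule char_poly_corner_right_mult_left) (use assms in auto)
  also have "monom 1 n * ?q = monom 1 3 * (monom 1 (n - 3) * ?q)"
    using assms by (simp only: mult.assoc[symmetric] mult_monom) simp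
  finally have "char_poly (corner_left n * corner_right x n) = monom 1 (n - 3) * ?q"
    by (subst (asm) mult_left_cancel) (simp_all only: monom_eq_0_iff one_neq_zero not_False_eq_True)
  then show ?thesis
    using assms CPC_factor[of n x] by simp
qed

section \<open>The cubic factor\<close>

text \<open>A real root \<open>r > N\<close> splits off, and the remaining factor is \<open>z\<^sup>2 + s z + r s\<close> with
  \<open>s = r - N\<close>. Its discriminant \<open>s (s - 4 r)\<close> is negative, since \<open>0 < s < r\<close>, and its two
  conjugate roots have squared modulus \<open>r s < r\<^sup>2\<close>.\<close>

lemma cubic_roots:
  fixes N c r :: real
  assumes "0 < N" and "N < r" and c: "r ^ 3 - N * r\<^sup>2 = c"
  obtains w where "{z::complex. z ^ 3 - of_real N * z\<^sup>2 - of_real c = 0} = {of_real r, w, cnj w}"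
    and "w \<notin> \<real>" and "cmod w < r"
proof -
  define s where "s = r - N"
  have s: "0 < s" "s < r" using assms by (auto simp: s_def)
  define d where "d = sqrt (r * s - s\<^sup>2 / 4)"
  define w where "w = Complex (- s / 2) d"
  have "r * s - s\<^sup>2 / 4 > 0"
  proof -
    have "s * s < r * s" using s by simp
    moreover have "0 < s * s" using s by simp
    ultimately show ?thesis by (simp add: power2_eq_square)
  qed
  then have d: "d > 0" "d\<^sup>2 = r * s - s\<^sup>2 / 4" by (auto simp: d_def)
  have sum: "w + cnj w = - of_real s" and prod: "w * cnj w = of_real (r * s)"
    using d by (auto simp: w_def complex_eq_iff power2_eq_square algebra_simps)
  have "z ^ 3 - of_real N * z\<^sup>2 - of_real c = (z - of_real r) * ((z - w) * (z - cnj w))" for z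
  proof -
    have "(z - w) * (z - cnj w) = z\<^sup>2 - (w + cnj w) * z + w * cnj w"
      by (simp add: algebra_simps power2_eq_square)
    also have "\<dots> = z\<^sup>2 + of_real s * z + of_real (r * s)"
      unfolding sum prod by simp
    finally have quadratic: "(z - w) * (z - cnj w) = z\<^sup>2 + of_real s * z + of_real (r * s)" .
    show ?thesis
      unfolding quadratic
      by (simp add: c[symmetric] s_def algebra_simps power2_eq_square power3_eq_cube)
  qed
  then have "{z::complex. z ^ 3 - of_real N * z\<^sup>2 - of_real c = 0} = {of_real r, w, cnj w}"
    by auto
  moreover have "w \<notin> \<real>" using d by (simp add: w_def complex_is_Real_iff)
  moreover have "cmod w < r"
  proof -
    have "(cmod w)\<^sup>2 = r * s" by (simp add: w_def cmod_power2 d power_divide)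
    also have "\<dots> < r\<^sup>2" using s by (simp add: power2_eq_square)
    finally show ?thesis using s by (simp add: power2_less_imp_less)
  qed
  ultimately show ?thesis by (rule that)
qed

text \<open>With \<open>t = B + N\<^sup>2 / (9 B)\<close> the product of the two summands is \<open>N\<^sup>2 / 9\<close>, so
  \<open>t\<^sup>3 = B\<^sup>3 + (N\<^sup>2 / 9)\<^sup>3 / B\<^sup>3 + (N\<^sup>2 / 3) t\<close>. The hypothesis makes \<open>B\<^sup>3\<close> the larger root of
  the quadratic with root sum \<open>2 N\<^sup>3 / 27 + c\<close> and root product \<open>(N\<^sup>2 / 9)\<^sup>3\<close>, so the first two
  terms add up to \<open>2 N\<^sup>3 / 27 + c\<close>; this is the depressed cubic. The bound \<open>N < r\<close> is the strict
  inequality of arithmetic and geometric means for the two summands, which differ because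
  \<open>B > N / 3\<close>.\<close>

lemma cardano:
  fixes N c B :: real
  assumes "0 < N" and "0 < c"
  assumes B: "B ^ 3 = N ^ 3 / 27 + sqrt (c\<^sup>2 / 4 + N ^ 3 * c / 27) + c / 2"
  defines "r \<equiv> B + N\<^sup>2 / (9 * B) + N / 3"
  shows "r ^ 3 - N * r\<^sup>2 = c" and "N < r"
proof -
  define b where "b = B ^ 3"
  define t where "t = B + N\<^sup>2 / (9 * B)"
  have "N ^ 3 / 27 < b"
    using assms by (simp add: b_def add_nonneg_pos)
  then have "(N / 3) ^ 3 < B ^ 3" by (simp add: b_def power_divide)
  moreover have "B \<le> N / 3 \<Longrightarrow> B ^ 3 \<le> (N / 3) ^ 3"
    by (rule power_mono_odd) auto
  ultimately have NB: "N / 3 < B" by linarith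
  then have Bpos: "B > 0" using assms by linarith
  have "t - 2 * N / 3 = (B - N / 3)\<^sup>2 / B"
    using Bpos by (simp add: t_def field_simps power2_eq_square)
  also have "\<dots> > 0" using NB Bpos by simp
  finally show "N < r" by (simp add: r_def t_def)
  have "(b - N ^ 3 / 27 - c / 2)\<^sup>2 = c\<^sup>2 / 4 + N ^ 3 * c / 27"
    using assms by (simp add: b_def)
  then have "b\<^sup>2 + N ^ 6 / 729 = (2 * N ^ 3 / 27 + c) * b"
    by (simp add: power2_eq_square field_simps)
  then have vieta: "b + N ^ 6 / (729 * b) = 2 * N ^ 3 / 27 + c"
    using Bpos by (simp add: b_def field_simps power2_eq_square)
  have "t ^ 3 = b + N ^ 6 / (729 * b) + N\<^sup>2 / 3 * t"
    using Bpos unfolding t_def b_def by (simp add: field_simps eval_nat_numeral)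
  then have "t ^ 3 = 2 * N ^ 3 / 27 + c + N\<^sup>2 / 3 * t" using vieta by simp
  moreover have "(t + N / 3) ^ 3 - N * (t + N / 3)\<^sup>2 = t ^ 3 - N\<^sup>2 / 3 * t - 2 * N ^ 3 / 27"
    by (simp add: eval_nat_numeral field_simps)
  ultimately show "r ^ 3 - N * r\<^sup>2 = c"
    by (simp add: r_def t_def)
qed

text \<open>The radicand \<open>S\<close> in the definition of \<open>B\<close> is Cardano's discriminant with the square of
  \<open>(x - 1) / (6 sqrt(3) x)\<close> taken out.\<close>

lemma CPC_B_cube:
  assumes "n \<ge> 2" and "x > 1"
  defines "c \<equiv> (real n - 2) * (x - 1)\<^sup>2 / x"
  shows "CPC_B x n ^ 3 = real n ^ 3 / 27 + sqrt (c\<^sup>2 / 4 + real n ^ 3 * c / 27) + c / 2"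
proof -
  define S where "S = 4 * real n ^ 3 * (real n - 2) * x + 27 * (real n - 2)\<^sup>2 * (x - 1)\<^sup>2"
  have "((x - 1) / (6 * sqrt 3 * x))\<^sup>2 = (x - 1)\<^sup>2 / (108 * x\<^sup>2)"
    by (simp add: power_divide power_mult_distrib)
  moreover have "c\<^sup>2 / 4 + real n ^ 3 * c / 27 = S * ((x - 1)\<^sup>2 / (108 * x\<^sup>2))"
  proof -
    have "c * x = (real n - 2) * (x - 1)\<^sup>2" using assms by (simp add: c_def)
    moreover have "S * (x - 1)\<^sup>2 = 4 * real n ^ 3 * x * ((real n - 2) * (x - 1)\<^sup>2)
        + 27 * ((real n - 2) * (x - 1)\<^sup>2)\<^sup>2"
      by (simp add: S_def algebra_simps power2_eq_square)
    ultimately have "S * (x - 1)\<^sup>2 = 4 * real n ^ 3 * x * (c * x) + 27 * (c * x)\<^sup>2" by simp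
    then show ?thesis using assms by (simp add: field_simps power2_eq_square)
  qed
  ultimately have "c\<^sup>2 / 4 + real n ^ 3 * c / 27 = S * ((x - 1) / (6 * sqrt 3 * x))\<^sup>2" by simp
  then have "sqrt (c\<^sup>2 / 4 + real n ^ 3 * c / 27) = (x - 1) * sqrt S / (6 * sqrt 3 * x)"
    using assms by (simp add: real_sqrt_mult)
  then show ?thesis
    by (simp add: CPC_B_def odd_real_root_pow c_def S_def)
qed

section \<open>Eigenvalues and Perron root of the corner matrix\<close>

theorem mainTheorem5:
  fixes n :: nat and x :: real
  assumes "n \<ge> 3" and "x > 1"
  shows "alg_mult (CPC_complex x n) 0 = n - 3
    \<and> (\<exists>(r::real) (z::complex). r > 0 \<and> z \<notin> \<real> \<and>
         spectrum (CPC_complex x n) - {0} = {complex_of_real r, z, cnj z})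
    \<and> perron_root (CPC x n) =
         CPC_B x n + (real n)\<^sup>2 / (9 * CPC_B x n) + real n / 3"
proof -
  define c where "c = (real n - 2) * (x - 1)\<^sup>2 / x"
  define r where "r = CPC_B x n + (real n)\<^sup>2 / (9 * CPC_B x n) + real n / 3"
  define q :: "complex poly" where "q = [:- of_real c, 0, - of_nat n, 1:]"
  have c: "c > 0" using assms by (simp add: c_def)
  have r: "r ^ 3 - real n * r\<^sup>2 = c" "real n < r"
    using cardano[OF _ c CPC_B_cube[of n x, folded c_def]] assms by (auto simp: r_def)
  obtain w where
    roots: "{z::complex. z ^ 3 - of_real (real n) * z\<^sup>2 - of_real c = 0} = {of_real r, w, cnj w}"
    and w: "w \<notin> \<real>" "cmod w < r"
    by (rule cubic_roots[OF _ r(2,1)]) (use assms in auto)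
  have poly_q: "poly q z = z ^ 3 - of_real (real n) * z\<^sup>2 - of_real c" for z
    by (simp add: q_def algebra_simps power2_eq_square power3_eq_cube)
  have cp: "char_poly (CPC_complex x n) = monom 1 (n - 3) * q"
    using char_poly_CPC[of n x] assms by (simp add: q_def c_def)
  have q0: "poly q 0 \<noteq> 0" using c by (simp add: q_def)
  have carr: "CPC_complex x n \<in> carrier_mat n n" by (simp add: CPC_def)
  have "order 0 (monom 1 (n - 3) * q) = n - 3"
  proof -
    have "monom 1 (n - 3) * q \<noteq> 0" using q0 by (auto simp: monom_eq_0_iff)
    moreover have "order (0::complex) (monom 1 (n - 3)) = n - 3"
      using order_power_n_n[of "0::complex" "n - 3"] by (simp add: monom_altdef)
    ultimately show ?thesis using q0 by (simp add: order_mult order_0I)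
  qed
  then have mult: "alg_mult (CPC_complex x n) 0 = n - 3" by (simp add: alg_mult_def cp)
  have spec: "spectrum (CPC_complex x n) - {0} = {of_real r, w, cnj w}"
  proof -
    have "spectrum (CPC_complex x n) - {0} = {z. poly q z = 0}"
      using q0 by (auto simp: spectrum_root_char_poly[OF carr] cp poly_monom)
    then show ?thesis by (simp only: poly_q roots)
  qed
  have rpos: "r > 0" using r by linarith
  have "spectral_radius (CPC_complex x n) = r"
  proof (rule antisym)
    have "0 < n" using assms by simp
    note sr = spectral_radius_mem_max[OF carr this]
    have "norm z \<le> r" if "z \<in> spectrum (CPC_complex x n)" for z
    proof -
      have "z \<in> {0, of_real r, w, cnj w}" using that spec by blast
      then show ?thesis using w(2) rpos by auto
    qed
    then show "spectral_radius (CPC_complex x n) \<le> r" using sr(1) by auto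
    show "r \<le> spectral_radius (CPC_complex x n)"
    proof (rule sr(2))
      have "of_real r \<in> spectrum (CPC_complex x n)" using spec by blast
      then show "r \<in> norm ` spectrum (CPC_complex x n)" using rpos by (force intro: rev_image_eqI)
    qed
  qed
  then have "perron_root (CPC x n) = CPC_B x n + (real n)\<^sup>2 / (9 * CPC_B x n) + real n / 3"
    by (simp only: perron_root_def r_def)
  with mult spec w(1) rpos show ?thesis by blast
qed

end
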